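(* Let $n \ge 0$ and let $\lambda, \mu$ be noncrossing partitions of size $n$. Let $\le$ denote the relation on the set of excedance classes $S_n/\!\sim$ induced by the Bruhat order, i.e. $\mathcal{C}_\lambda \le \mathcal{C}_\mu$ if and only if there exist $v \in \mathcal{C}_\lambda$ and $w \in \mathcal{C}_\mu$ with $v \le w$ in the Bruhat order on $S_n$. Then $\mathcal{C}_\lambda \le \mathcal{C}_\mu$ if and only if $\lambda \preceq \mu$.
   Context: Write $[n] = \{1,\dots,n\}$ and let $S_n$ be the group of permutations of $[n]$, with $w_i = w(i)$; the Bruhat order on $S_n$ is the usual (strong) Bruhat order. A noncrossing partition of size $n$ is a set $\lambda$ of arcs $(i,j)$ with $1 \le i < j \le n$ such that there are no two distinct arcs $(i,k), (j,l) \in \lambda$ with $i \le j < k \le l$. For an arc $(i,j)\in\lambda$, $i$ is its left endpoint and $j$ its right endpoint. $\lambda^{+}$ (resp. $\lambda^{-}$) denotes the set of all left (resp. right) endpoints of arcs of $\lambda$. The order $\preceq$ on the noncrossing partitions of size $n$ is the partial order generated by the covering relations: $\lambda$ is covered by $\mu$ iff $\lambda$ is obtained from $\mu$ either (1) by removing an arc of the form $(i,i+1)$ from $\mu$, or (2) by replacing an arc $(i,k)$ of $\mu$ with two arcs $(i,j)$ and $(j,k)$, for some $i<j<k$, which do not cross, or share a left endpoint or share a right endpoint with, any other arc of $\mu$. For $w \in S_n$, set $E_{pos}(w) = \{ i \in [n] : i \le w_i\}$ and $E_{val}(w) = \{ w_i : i\in[n],\ i \le w_i\}$. The excedance relation on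 $S_n$ is: $v \sim w$ iff $E_{val}(v) = E_{val}(w)$ and $E_{pos}(v)=E_{pos}(w)$; its equivalence classes are called excedance classes. For a noncrossing partition $\lambda$ of size $n$, $\mathcal{C}_\lambda = \{ w \in S_n : E_{val}(w) = [n] \setminus \lambda^{+} \text{ and } E_{pos}(w) = [n]\setminus \lambda^{-}\}$, which is an excedance class. *)

theory Defs
  imports Main "HOL-Combinatorics.Permutations"
begin

definition Sym :: "nat \<Rightarrow> (nat \<Rightarrow> nat) set" where
  "Sym n = {w. w permutes {1..n}}"

definition inversions :: "nat \<Rightarrow> (nat \<Rightarrow> nat) \<Rightarrow> (nat \<times> nat) set" where
  "inversions n w = {(i, j). i \<in> {1..n} \<and> j \<in> {1..n} \<and> i < j \<and> w j < w i}"

(* The Coxeter length of a permutation is its number of inversions. *)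
definition len :: "nat \<Rightarrow> (nat \<Rightarrow> nat) \<Rightarrow> nat" where
  "len n w = card (inversions n w)"

(* Strong Bruhat order: the reflexive transitive closure of v \<rightarrow> v t
   for reflections (transpositions) t with len v < len (v t). *)
definition bruhat_step :: "nat \<Rightarrow> (nat \<Rightarrow> nat) \<Rightarrow> (nat \<Rightarrow> nat) \<Rightarrow> bool" where
  "bruhat_step n v w \<longleftrightarrow> v \<in> Sym n \<and> w \<in> Sym n \<and> len n v < len n w \<and>
     (\<exists>a \<in> {1..n}. \<exists>b \<in> {1..n}. a \<noteq> b \<and> w = v \<circ> transpose a b)"

definition bruhat_le :: "nat \<Rightarrow> (nat \<Rightarrow> nat) \<Rightarrow> (nat \<Rightarrow> nat) \<Rightarrow> bool" where
  "bruhat_le n = (bruhat_step n)\<^sup>*\<^sup>*"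

definition noncrossing_partition :: "nat \<Rightarrow> (nat \<times> nat) set \<Rightarrow> bool" where
  "noncrossing_partition n lam \<longleftrightarrow>
     (\<forall>(i, j) \<in> lam. 1 \<le> i \<and> i < j \<and> j \<le> n) \<and>
     \<not> (\<exists>i j k l. (i, k) \<in> lam \<and> (j, l) \<in> lam \<and> (i, k) \<noteq> (j, l) \<and>
          i \<le> j \<and> j < k \<and> k \<le> l)"

definition left_endpoints :: "(nat \<times> nat) set \<Rightarrow> nat set" where
  "left_endpoints lam = fst ` lam"

definition right_endpoints :: "(nat \<times> nat) set \<Rightarrow> nat set" where
  "right_endpoints lam = snd ` lam"

definition arcs_cross :: "nat \<times> nat \<Rightarrow> nat \<times> nat \<Rightarrow> bool" where
  "arcs_cross a b \<longleftrightarrow>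
     fst a < fst b \<and> fst b < snd a \<and> snd a < snd b \<or>
     fst b < fst a \<and> fst a < snd b \<and> snd b < snd a"

(* nc_cover n lam mu: lam is the smaller partition, mu the larger one. *)
definition nc_cover :: "nat \<Rightarrow> (nat \<times> nat) set \<Rightarrow> (nat \<times> nat) set \<Rightarrow> bool" where
  "nc_cover n lam mu \<longleftrightarrow> noncrossing_partition n lam \<and> noncrossing_partition n mu \<and>
     ((\<exists>i. (i, i + 1) \<in> mu \<and> lam = mu - {(i, i + 1)}) \<or>
      (\<exists>i j k. i < j \<and> j < k \<and> (i, k) \<in> mu \<and>
         (\<forall>a \<in> {(i, j), (j, k)}. \<forall>b \<in> mu - {(i, k)}.
            \<not> arcs_cross a b \<and> fst a \<noteq> fst b \<and> snd a \<noteq> snd b) \<and>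
         lam = (mu - {(i, k)}) \<union> {(i, j), (j, k)}))"

definition nc_le :: "nat \<Rightarrow> (nat \<times> nat) set \<Rightarrow> (nat \<times> nat) set \<Rightarrow> bool" where
  "nc_le n = (nc_cover n)\<^sup>*\<^sup>*"

definition E_pos :: "nat \<Rightarrow> (nat \<Rightarrow> nat) \<Rightarrow> nat set" where
  "E_pos n w = {i \<in> {1..n}. i \<le> w i}"

definition E_val :: "nat \<Rightarrow> (nat \<Rightarrow> nat) \<Rightarrow> nat set" where
  "E_val n w = {w i | i. i \<in> {1..n} \<and> i \<le> w i}"

definition excedance_rel :: "nat \<Rightarrow> ((nat \<Rightarrow> nat) \<times> (nat \<Rightarrow> nat)) set" where
  "excedance_rel n = {(v, w). v \<in> Sym n \<and> w \<in> Sym n \<and>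
     E_val n v = E_val n w \<and> E_pos n v = E_pos n w}"

definition excedance_classes :: "nat \<Rightarrow> (nat \<Rightarrow> nat) set set" where
  "excedance_classes n = Sym n // excedance_rel n"

definition class_le :: "nat \<Rightarrow> (nat \<Rightarrow> nat) set \<Rightarrow> (nat \<Rightarrow> nat) set \<Rightarrow> bool" where
  "class_le n A B \<longleftrightarrow> A \<in> excedance_classes n \<and> B \<in> excedance_classes n \<and>
     (\<exists>v \<in> A. \<exists>w \<in> B. bruhat_le n v w)"

definition nc_class :: "nat \<Rightarrow> (nat \<times> nat) set \<Rightarrow> (nat \<Rightarrow> nat) set" where
  "nc_class n lam = {w \<in> Sym n. E_val n w = {1..n} - left_endpoints lam \<and>
     E_pos n w = {1..n} - right_endpoints lam}"

end

theory Submission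
  imports Defs
begin

text \<open>Counting the arcs \<open>(i, j)\<close> with \<open>2 * i < t < 2 * j\<close> turns a noncrossing partition into the
  heights of a Dyck path, and \<open>nc_le\<close> becomes containment of Dyck paths: a covering relation removes
  one box, at odd \<open>t\<close> by deleting an arc \<open>(i, i + 1)\<close> and at even \<open>t\<close> by splitting an arc.
  For \<open>w\<close> in the class of \<open>lam\<close> and \<open>b \<in> {a, a + 1}\<close>, the number of \<open>i \<le> a\<close> with \<open>w i \<ge> b\<close>
  depends only on \<open>E_pos\<close> and \<open>E_val\<close> and is such a height up to a constant; as these numbers
  increase along the Bruhat order, Bruhat comparability forces containment. Conversely, the
  permutations whose cycles are the blocks represent the classes in such a way that each covering
  relation becomes multiplication by one length-increasing transposition.\<close>

section \<open>Depth functions of noncrossing partitions\<close>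

text \<open>Doubled coordinates put the vertex \<open>a\<close> at \<open>2 * a\<close> and the gap
  between \<open>a\<close> and \<open>a + 1\<close> at \<open>2 * a + 1\<close>, so one function
  records both the arcs passing strictly over a vertex and the arcs over a gap.\<close>

definition depth :: "(nat \<times> nat) set \<Rightarrow> nat \<Rightarrow> nat" where
  "depth lam t = card {(i, j) \<in> lam. 2 * i < t \<and> t < 2 * j}"

lemma noncrossing_partitionD:
  assumes "noncrossing_partition n lam"
  shows "(i, j) \<in> lam \<Longrightarrow> 1 \<le> i \<and> i < j \<and> j \<le> n"
    and "(i, k) \<in> lam \<Longrightarrow> (j, l) \<in> lam \<Longrightarrow> i \<le> j \<Longrightarrow> j < k \<Longrightarrow> k \<le> l \<Longrightarrow> i = j \<and> k = l"
  using assms unfolding noncrossing_partition_def by blast+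

lemma finite_noncrossing_partition:
  assumes "noncrossing_partition n lam"
  shows "finite lam"
proof (rule finite_subset)
  show "lam \<subseteq> {1..n} \<times> {1..n}"
    using noncrossing_partitionD(1)[OF assms] by fastforce
qed simp

lemma noncrossing_left_unique:
  assumes "noncrossing_partition n lam" "(i, j) \<in> lam" "(i, k) \<in> lam"
  shows "j = k"
  using noncrossing_partitionD[OF assms(1)] assms(2,3) by (metis le_refl nle_le)

lemma noncrossing_right_unique:
  assumes "noncrossing_partition n lam" "(i, k) \<in> lam" "(j, k) \<in> lam"
  shows "i = j"
  using noncrossing_partitionD[OF assms(1)] assms(2,3) by (metis le_refl nle_le)

lemma depth_empty [simp]: "depth {} t = 0"
  by (simp add: depth_def)

lemma depth_insert:
  assumes "finite lam" "(i, j) \<notin> lam"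
  shows "depth (insert (i, j) lam) t = depth lam t + (if 2 * i < t \<and> t < 2 * j then 1 else 0)"
proof -
  let ?C = "{(i, j) \<in> lam. 2 * i < t \<and> t < 2 * j}"
  have "{(p, q) \<in> insert (i, j) lam. 2 * p < t \<and> t < 2 * q} =
      (if 2 * i < t \<and> t < 2 * j then insert (i, j) ?C else ?C)"
    by auto
  moreover have "finite ?C" "(i, j) \<notin> ?C"
    using assms by (auto intro: finite_subset[of _ lam])
  ultimately show ?thesis
    unfolding depth_def by (cases "2 * i < t \<and> t < 2 * j") (simp_all only: if_True if_False
      card_insert_disjoint not_False_eq_True simp_thms add_Suc_right add_0_right Suc_eq_plus1)
qed

lemma depth_eq_0:
  assumes "noncrossing_partition n lam" "2 * n \<le> t"
  shows "depth lam t = 0"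
proof -
  have "{(i, j) \<in> lam. 2 * i < t \<and> t < 2 * j} = {}"
    using noncrossing_partitionD(1)[OF assms(1)] assms(2) by fastforce
  then show ?thesis
    unfolding depth_def by (metis card.empty)
qed

lemma depth_cong:
  assumes "\<And>p q. (p, q) \<in> lam \<Longrightarrow> 2 * p < s \<and> s < 2 * q \<longleftrightarrow> 2 * p < t \<and> t < 2 * q"
  shows "depth lam s = depth lam t"
proof -
  have "{(p, q) \<in> lam. 2 * p < s \<and> s < 2 * q} = {(p, q) \<in> lam. 2 * p < t \<and> t < 2 * q}"
    using assms by blast
  then show ?thesis
    unfolding depth_def by (rule arg_cong)
qed

lemma depth_remove:
  assumes "finite lam" "(i, j) \<in> lam"
  shows "depth lam t = depth (lam - {(i, j)}) t + (if 2 * i < t \<and> t < 2 * j then 1 else 0)"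
  using depth_insert[of "lam - {(i, j)}" i j t] assms by (simp add: insert_absorb)

section \<open>Recovering a partition from its depths\<close>

text \<open>Moving from the vertex \<open>i\<close> into the gap after it can only pick up an arc
  starting at \<open>i\<close>, and there is at most one. Together with
  \<open>depth_right_step\<close>, this makes the endpoint sets readable from the changes of
  depth.\<close>

lemma depth_left_step:
  assumes "noncrossing_partition n lam"
  shows "depth lam (Suc (2 * i)) = depth lam (2 * i) + (if i \<in> left_endpoints lam then 1 else 0)"
proof -
  \<comment> \<open>Stated for an arbitrary arc set because it is also applied to \<open>lam\<close>
    without the arc at \<open>i\<close>.\<close>
  have same: "depth mu (Suc (2 * i)) = depth mu (2 * i)" if "i \<notin> left_endpoints mu" for mu
  proof (rule depth_cong)
    fix p q assume "(p, q) \<in> mu"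
    then have "p \<noteq> i"
      using that unfolding left_endpoints_def by force
    then show "2 * p < Suc (2 * i) \<and> Suc (2 * i) < 2 * q \<longleftrightarrow> 2 * p < 2 * i \<and> 2 * i < 2 * q"
      by presburger
  qed
  show ?thesis
  proof (cases "i \<in> left_endpoints lam")
    case False
    then show ?thesis
      using same[of lam] by simp
  next
    case True
    then obtain j where j: "(i, j) \<in> lam"
      unfolding left_endpoints_def by auto
    have "i \<notin> left_endpoints (lam - {(i, j)})"
      using noncrossing_left_unique[OF assms j] unfolding left_endpoints_def by auto
    moreover have "i < j"
      using noncrossing_partitionD(1)[OF assms j] by simp
    ultimately show ?thesis
      using True same[of "lam - {(i, j)}"] depth_remove[OF finite_noncrossing_partition[OF assms] j]
      by simp
  qed
qed

lemma depth_right_step: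
  assumes "noncrossing_partition n lam"
  shows "depth lam (Suc (2 * j)) =
    depth lam (Suc (Suc (2 * j))) + (if Suc j \<in> right_endpoints lam then 1 else 0)"
proof -
  have same: "depth mu (Suc (2 * j)) = depth mu (Suc (Suc (2 * j)))"
    if "Suc j \<notin> right_endpoints mu" for mu
  proof (rule depth_cong)
    fix p q assume "(p, q) \<in> mu"
    then have "q \<noteq> Suc j"
      using that unfolding right_endpoints_def by force
    then show "2 * p < Suc (2 * j) \<and> Suc (2 * j) < 2 * q \<longleftrightarrow>
        2 * p < Suc (Suc (2 * j)) \<and> Suc (Suc (2 * j)) < 2 * q"
      by presburger
  qed
  show ?thesis
  proof (cases "Suc j \<in> right_endpoints lam")
    case False
    then show ?thesis
      using same[of lam] by simp
  next
    case True
    then obtain i where i: "(i, Suc j) \<in> lam"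
      unfolding right_endpoints_def by auto
    have "Suc j \<notin> right_endpoints (lam - {(i, Suc j)})"
      using noncrossing_right_unique[OF assms i] unfolding right_endpoints_def by auto
    moreover have "i < Suc j"
      using noncrossing_partitionD(1)[OF assms i] by simp
    ultimately show ?thesis
      using True same[of "lam - {(i, Suc j)}"]
        depth_remove[OF finite_noncrossing_partition[OF assms] i] by simp
  qed
qed

text \<open>An arc over the gap after \<open>i\<close> that ends at or before \<open>k\<close> is
  \<open>(i, k)\<close> itself, by noncrossing; one that ends after \<open>k\<close> encloses
  \<open>(i, k)\<close>. Either way it lies over every point strictly between \<open>i\<close> and
  \<open>k\<close>.\<close>

lemma depth_below_arc:
  assumes "noncrossing_partition n lam" "(i, k) \<in> lam" "2 * i < t" "t < 2 * k"
  shows "depth lam (Suc (2 * i)) \<le> depth lam t"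
  unfolding depth_def
proof (rule card_mono)
  show "finite {(i, j) \<in> lam. 2 * i < t \<and> t < 2 * j}"
    by (rule finite_subset[OF _ finite_noncrossing_partition[OF assms(1)]]) auto
  show "{(p, q) \<in> lam. 2 * p < Suc (2 * i) \<and> Suc (2 * i) < 2 * q}
      \<subseteq> {(p, q) \<in> lam. 2 * p < t \<and> t < 2 * q}"
  proof clarify
    fix p q assume "(p, q) \<in> lam" "2 * p < Suc (2 * i)" "Suc (2 * i) < 2 * q"
    then show "2 * p < t \<and> t < 2 * q"
      using noncrossing_partitionD(2)[OF assms(1), of p q i k] assms by (cases "q \<le> k") auto
  qed
qed

text \<open>By noncrossing, an arc over \<open>k\<close> starts before \<open>i\<close> and so
  encloses \<open>(i, k)\<close>; the arc \<open>(i, k)\<close> itself is counted in the gap after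
  \<open>i\<close> but no longer at \<open>k\<close>.\<close>

lemma depth_after_arc:
  assumes "noncrossing_partition n lam" "(i, k) \<in> lam"
  shows "depth lam (2 * k) < depth lam (Suc (2 * i))"
  unfolding depth_def
proof (rule psubset_card_mono)
  show "finite {(p, q) \<in> lam. 2 * p < Suc (2 * i) \<and> Suc (2 * i) < 2 * q}"
    by (rule finite_subset[OF _ finite_noncrossing_partition[OF assms(1)]]) auto
  have "2 * p < Suc (2 * i) \<and> Suc (2 * i) < 2 * q"
    if "(p, q) \<in> lam" "2 * p < 2 * k" "2 * k < 2 * q" for p q
    using noncrossing_partitionD(2)[OF assms(1), of i k p q] that
      noncrossing_partitionD(1)[OF assms] assms by (cases "i \<le> p") auto
  moreover have "(i, k) \<in> {(p, q) \<in> lam. 2 * p < Suc (2 * i) \<and> Suc (2 * i) < 2 * q}"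
    using assms noncrossing_partitionD(1)[OF assms] by auto
  ultimately show "{(p, q) \<in> lam. 2 * p < 2 * k \<and> 2 * k < 2 * q}
      \<subset> {(p, q) \<in> lam. 2 * p < Suc (2 * i) \<and> Suc (2 * i) < 2 * q}"
    by blast
qed

text \<open>The partner of a left endpoint \<open>i\<close> is the first vertex after
  \<open>i\<close> whose depth is smaller than that of the gap after \<open>i\<close>, so the depths
  determine every arc.\<close>

lemma depth_inj:
  assumes lam: "noncrossing_partition n lam" and mu: "noncrossing_partition n mu"
    and eq: "depth lam = depth mu"
  shows "lam = mu"
proof -
  have subset: "lam \<subseteq> mu"
    if lam: "noncrossing_partition n lam" and mu: "noncrossing_partition n mu"
      and eq: "depth lam = depth mu" for lam mu
  proof clarify
    fix i k assume ik: "(i, k) \<in> lam"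
    then have "i \<in> left_endpoints lam"
      unfolding left_endpoints_def by force
    then have "i \<in> left_endpoints mu"
      using depth_left_step[OF lam, of i] depth_left_step[OF mu, of i] eq by (auto split: if_splits)
    then obtain l where il: "(i, l) \<in> mu"
      unfolding left_endpoints_def by auto
    have "i < k" "i < l"
      using noncrossing_partitionD(1)[OF lam ik] noncrossing_partitionD(1)[OF mu il] by auto
    then have "\<not> k < l" "\<not> l < k"
      using depth_below_arc[OF mu il, of "2 * k"] depth_after_arc[OF lam ik]
        depth_below_arc[OF lam ik, of "2 * l"] depth_after_arc[OF mu il] eq by auto
    then show "(i, k) \<in> mu"
      using il by (metis linorder_neqE_nat)
  qed
  show ?thesis
    using subset[OF lam mu eq] subset[OF mu lam eq[symmetric]] by blast
qed

section \<open>Covering relations and containment of depths\<close>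

lemma cover_remove_arc:
  assumes mu: "noncrossing_partition n mu"
    and "a \<in> left_endpoints mu" "Suc a \<in> right_endpoints mu"
  obtains nu where "nc_cover n nu mu"
    and "depth nu = (depth mu)(Suc (2 * a) := depth mu (Suc (2 * a)) - 1)"
proof -
  obtain i k where ik: "(a, k) \<in> mu" "(i, Suc a) \<in> mu"
    using assms(2,3) unfolding left_endpoints_def right_endpoints_def by auto
  \<comment> \<open>The arc leaving \<open>a\<close> and the arc entering \<open>Suc a\<close> both
    lie over the gap between them; noncrossing forces them to coincide.\<close>
  then have arc: "(a, Suc a) \<in> mu"
    using noncrossing_partitionD[OF mu ik(1)] noncrossing_partitionD[OF mu ik(2)]
    by (metis Suc_leI lessI less_Suc_eq_le)
  let ?nu = "mu - {(a, Suc a)}"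
  have nu: "noncrossing_partition n ?nu"
    using mu unfolding noncrossing_partition_def by blast
  have "nc_cover n ?nu mu"
    using mu nu arc unfolding nc_cover_def by auto
  moreover have "depth ?nu = (depth mu)(Suc (2 * a) := depth mu (Suc (2 * a)) - 1)"
    using depth_remove[OF finite_noncrossing_partition[OF mu] arc] by (intro ext) auto
  ultimately show ?thesis
    using that by blast
qed

text \<open>The innermost arc over the isolated vertex \<open>a\<close> is split at
  \<open>a\<close>. The two halves lie over the same points as the whole arc, except for
  \<open>a\<close> itself.\<close>

lemma cover_split_arc:
  assumes mu: "noncrossing_partition n mu"
    and a: "a \<notin> left_endpoints mu" "a \<notin> right_endpoints mu" and pos: "0 < depth mu (2 * a)"
  obtains nu where "nc_cover n nu mu"
    and "depth nu = (depth mu)(2 * a := depth mu (2 * a) - 1)"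
proof -
  have "{(i, j) \<in> mu. 2 * i < 2 * a \<and> 2 * a < 2 * j} \<noteq> {}"
    using pos unfolding depth_def by (metis card.empty less_irrefl)
  then have "\<exists>x. x \<in> mu \<and> fst x < a \<and> a < snd x"
    by force
  \<comment> \<open>A shortest arc over \<open>a\<close> is needed: an arc over \<open>a\<close>
    nested strictly inside \<open>(i, k)\<close> would cross the half \<open>(i, a)\<close>.\<close>
  then obtain x where x: "x \<in> mu \<and> fst x < a \<and> a < snd x"
      "\<And>y. y \<in> mu \<and> fst y < a \<and> a < snd y \<Longrightarrow> snd x - fst x \<le> snd y - fst y"
    using ex_has_least_nat[of "\<lambda>x. x \<in> mu \<and> fst x < a \<and> a < snd x" _ "\<lambda>x. snd x - fst x"]
    by blast
  obtain i k where xik: "x = (i, k)" by (cases x)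
  have ik: "(i, k) \<in> mu" "i < a" "a < k"
    using x(1) xik by auto
  let ?rest = "mu - {(i, k)}"
  let ?nu = "?rest \<union> {(i, a), (a, k)}"
  \<comment> \<open>These are the possible positions of another arc relative to \<open>i\<close>,
    \<open>a\<close> and \<open>k\<close>. Touching at \<open>q = i\<close> or \<open>p = k\<close>
    is allowed, since consecutive arcs of a block share a vertex.\<close>
  have pos_rest: "q < i \<or> q = i \<or> k \<le> p \<or> (p < i \<and> k < q) \<or> (i < p \<and> q < a) \<or> (a < p \<and> q < k)"
    and range: "1 \<le> p \<and> p < q \<and> q \<le> n \<and> p \<noteq> a \<and> q \<noteq> a" if "(p, q) \<in> ?rest" for p q
  proof -
    have pq: "(p, q) \<in> mu" "(p, q) \<noteq> (i, k)"
      using that by auto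
    show r: "1 \<le> p \<and> p < q \<and> q \<le> n \<and> p \<noteq> a \<and> q \<noteq> a"
      using noncrossing_partitionD(1)[OF mu pq(1)] a pq(1)
      unfolding left_endpoints_def right_endpoints_def by force
    have "\<not> (i \<le> p \<and> p < k \<and> k \<le> q)" "\<not> (p \<le> i \<and> i < q \<and> q \<le> k)"
      using noncrossing_partitionD(2)[OF mu ik(1) pq(1)] noncrossing_partitionD(2)[OF mu pq(1) ik(1)] pq(2)
      by auto
    moreover have "\<not> (i < p \<and> p < a \<and> a < q \<and> q < k)"
      using x(2)[of "(p, q)"] pq(1) xik by auto
    ultimately show "q < i \<or> q = i \<or> k \<le> p \<or> (p < i \<and> k < q) \<or> (i < p \<and> q < a) \<or> (a < p \<and> q < k)"
      using r by linarith
  qed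
  have ik_range: "1 \<le> i" "k \<le> n"
    using noncrossing_partitionD(1)[OF mu ik(1)] by auto
  have nu: "noncrossing_partition n ?nu"
    unfolding noncrossing_partition_def
  proof (intro conjI notI ballI)
    fix x assume "x \<in> ?nu"
    then show "case x of (i, j) \<Rightarrow> 1 \<le> i \<and> i < j \<and> j \<le> n"
      using range ik ik_range by (cases x) auto
  next
    assume "\<exists>i' j k' l. (i', k') \<in> ?nu \<and> (j, l) \<in> ?nu \<and> (i', k') \<noteq> (j, l) \<and> i' \<le> j \<and> j < k' \<and> k' \<le> l"
    then obtain p q r s where *: "(p, q) \<in> ?nu" "(r, s) \<in> ?nu" "(p, q) \<noteq> (r, s)" "p \<le> r" "r < q" "q \<le> s"
      by blast
    show False
    proof (cases "(p, q) \<in> ?rest"; cases "(r, s) \<in> ?rest")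
      assume "(p, q) \<in> ?rest" "(r, s) \<in> ?rest"
      then show False
        using noncrossing_partitionD(2)[OF mu, of p q r s] * by auto
    next
      assume "(p, q) \<in> ?rest" "(r, s) \<notin> ?rest"
      then show False
        using pos_rest[of p q] range[of p q] * ik by auto
    next
      assume "(p, q) \<notin> ?rest" "(r, s) \<in> ?rest"
      then show False
        using pos_rest[of r s] range[of r s] * ik by auto
    next
      assume "(p, q) \<notin> ?rest" "(r, s) \<notin> ?rest"
      then show False
        using * ik by auto
    qed
  qed
  have sep: "\<not> arcs_cross (i, a) (p, q) \<and> \<not> arcs_cross (a, k) (p, q) \<and> i \<noteq> p \<and> a \<noteq> p \<and> a \<noteq> q \<and> k \<noteq> q"
    if "(p, q) \<in> ?rest" for p q
    using pos_rest[OF that] range[OF that] ik unfolding arcs_cross_def by auto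
  have "\<not> arcs_cross x y \<and> fst x \<noteq> fst y \<and> snd x \<noteq> snd y"
    if "x \<in> {(i, a), (a, k)}" "y \<in> ?rest" for x y
    using sep[of "fst y" "snd y"] that by auto
  then have "nc_cover n ?nu mu"
    unfolding nc_cover_def using mu nu ik by blast
  moreover have "depth ?nu = (depth mu)(2 * a := depth mu (2 * a) - 1)"
  proof
    fix t
    have fin: "finite ?rest"
      using finite_noncrossing_partition[OF mu] by simp
    have notin: "(i, a) \<notin> insert (a, k) ?rest" "(a, k) \<notin> ?rest"
      using range[of i a] range[of a k] ik by auto
    have "?nu = insert (i, a) (insert (a, k) ?rest)"
      by auto
    then have nu_t: "depth ?nu t = depth ?rest t + (if 2 * a < t \<and> t < 2 * k then 1 else 0)
          + (if 2 * i < t \<and> t < 2 * a then 1 else 0)"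
      and mu_t: "depth mu t = depth ?rest t + (if 2 * i < t \<and> t < 2 * k then 1 else 0)"
      using depth_insert[OF fin notin(2), of t] depth_insert[OF _ notin(1), of t] fin
        depth_remove[OF finite_noncrossing_partition[OF mu] ik(1), of t] by simp_all
    have "depth ?nu t = (if t = 2 * a then depth mu t - 1 else depth mu t)"
      unfolding nu_t mu_t using ik by simp
    then show "depth ?nu t = ((depth mu)(2 * a := depth mu (2 * a) - 1)) t"
      by (metis fun_upd_apply)
  qed
  ultimately show ?thesis
    using that by blast
qed

text \<open>The height \<open>2 * depth mu t + (if even t then 1 else 0)\<close> traces a Dyck path. A highest point
  of the path of \<open>mu\<close> among those strictly above the path of \<open>lam\<close> is a peak, and cutting off a
  peak is a covering relation.\<close>

lemma ex_cover_above:
  assumes lam: "noncrossing_partition n lam" and mu: "noncrossing_partition n mu"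
    and le: "\<And>t. depth lam t \<le> depth mu t" and neq: "lam \<noteq> mu"
  obtains nu t where "nc_cover n nu mu" "depth lam t < depth mu t"
    and "depth nu = (depth mu)(t := depth mu t - 1)"
proof -
  define P where "P t \<longleftrightarrow> depth lam t < depth mu t" for t
  define height where "height t = 2 * depth mu t + (if even t then 1 else 0)" for t
  have "\<exists>t. P t"
    using depth_inj[OF lam mu] le neq unfolding P_def by (metis ext order_le_imp_less_or_eq)
  then obtain t0 where "P t0" ..
  have "P t \<Longrightarrow> t \<le> 2 * n" for t
    using depth_eq_0[OF mu, of t] unfolding P_def by (cases "t \<le> 2 * n") auto
  then have fin: "finite {t. P t}"
    by (auto intro: finite_subset[of _ "{..2 * n}"])
  obtain t where t: "P t" and max: "\<And>s. P s \<Longrightarrow> height s \<le> height t"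
  proof -
    have "Max (height ` {t. P t}) \<in> height ` {t. P t}"
      using fin \<open>P t0\<close> by (intro Max_in) auto
    moreover have "P s \<Longrightarrow> height s \<le> Max (height ` {t. P t})" for s
      using fin by (intro Max_ge) auto
    ultimately show ?thesis
      using that by (metis (no_types, lifting) imageE mem_Collect_eq)
  qed
  show ?thesis
  proof (cases "even t")
    case True
    then obtain a where a: "t = 2 * a"
      by blast
    \<comment> \<open>An arc of \<open>mu\<close> starting at \<open>a\<close> would make the path
      of \<open>mu\<close> rise in the next step. The depth of \<open>lam\<close> grows by at most
      one there, so that higher point would still satisfy \<open>P\<close>.\<close>
    have "a \<notin> left_endpoints mu"
      using depth_left_step[OF mu, of a] depth_left_step[OF lam, of a] t max[of "Suc (2 * a)"]
      unfolding P_def height_def a by (auto split: if_splits)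
    moreover have "a \<notin> right_endpoints mu"
    proof (cases a)
      case 0
      then show ?thesis
        using noncrossing_partitionD(1)[OF mu] unfolding right_endpoints_def by force
    next
      case (Suc b)
      then show ?thesis
        using depth_right_step[OF mu, of b] depth_right_step[OF lam, of b] t max[of "Suc (2 * b)"]
        unfolding P_def height_def a by (auto split: if_splits)
    qed
    moreover have "0 < depth mu (2 * a)"
      using t unfolding P_def a by simp
    ultimately show ?thesis
      using cover_split_arc[OF mu] that[of _ t] t unfolding a P_def by metis
  next
    case False
    then obtain a where a: "t = Suc (2 * a)"
      by (metis oddE Suc_eq_plus1)
    \<comment> \<open>Otherwise \<open>mu\<close> has the same depth at \<open>2 * a\<close>, hence
      a greater height, while the depth of \<open>lam\<close> there is no larger than at
      \<open>t\<close>; this contradicts maximality.\<close>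
    have "a \<in> left_endpoints mu"
      using depth_left_step[OF mu, of a] depth_left_step[OF lam, of a] t max[of "2 * a"]
      unfolding P_def height_def a by (auto split: if_splits)
    moreover have "Suc a \<in> right_endpoints mu"
      using depth_right_step[OF mu, of a] depth_right_step[OF lam, of a] t max[of "Suc (Suc (2 * a))"]
      unfolding P_def height_def a by (auto split: if_splits)
    ultimately show ?thesis
      using cover_remove_arc[OF mu] that[of _ t] t unfolding a P_def by metis
  qed
qed

text \<open>The area under the depths of \<open>mu\<close> drops with each covering step, and the
  step only lowers a point strictly above \<open>lam\<close>, so containment persists until the
  partitions agree.\<close>

lemma nc_le_if_depth_le:
  assumes "noncrossing_partition n lam" "noncrossing_partition n mu"
    and "\<And>t. depth lam t \<le> depth mu t"
  shows "nc_le n lam mu"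
  using assms
proof (induction "\<Sum>t<2 * n. depth mu t" arbitrary: mu rule: less_induct)
  case less
  show ?case
  proof (cases "lam = mu")
    case True
    then show ?thesis
      by (simp add: nc_le_def)
  next
    case False
    then obtain nu t where nu: "nc_cover n nu mu" "depth lam t < depth mu t"
        "depth nu = (depth mu)(t := depth mu t - 1)"
      using ex_cover_above less.prems by metis
    have ncnu: "noncrossing_partition n nu"
      using nu(1) unfolding nc_cover_def by blast
    have "t < 2 * n"
      using depth_eq_0[OF less.prems(2), of t] nu(2) by (cases "t < 2 * n") auto
    then have "(\<Sum>t<2 * n. depth nu t) < (\<Sum>t<2 * n. depth mu t)"
      using nu(2,3) by (intro sum_strict_mono_ex1) auto
    moreover have "depth lam s \<le> depth nu s" for s
      using less.prems(3)[of s] nu(2,3) by auto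
    ultimately have "nc_le n lam nu"
      using less.hyps ncnu less.prems(1) by blast
    then show ?thesis
      using nu(1) unfolding nc_le_def by (rule rtranclp.rtrancl_into_rtrancl)
  qed
qed

section \<open>Bruhat order and rank counts\<close>

lemma finite_inversions: "finite (inversions n w)"
  by (rule finite_subset[of _ "{1..n} \<times> {1..n}"]) (auto simp: inversions_def)

lemma len_less_transpose:
  assumes ab: "a \<in> {1..n}" "b \<in> {1..n}" "a < b" and less: "w a < w b"
  shows "len n w < len n (w \<circ> transpose a b)"
proof -
  let ?t = "transpose a b"
  let ?w = "w \<circ> ?t"
  \<comment> \<open>An inversion is moved by the transposition unless this would reverse the order
    of its positions, in which case it stays put and remains an inversion because
    \<open>w a < w b\<close>. The pair \<open>(a, b)\<close> is never hit, which gives the strict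
    increase.\<close>
  define f where "f = (\<lambda>(i, j). if ?t i < ?t j then (?t i, ?t j) else (i, j))"
  have t_range: "?t i \<in> {1..n} \<longleftrightarrow> i \<in> {1..n}" for i
    using ab by (auto simp: transpose_def)
  have inj: "inj_on f (inversions n w)"
  proof (rule inj_onI, clarify)
    fix i j k l
    assume "(i, j) \<in> inversions n w" "(k, l) \<in> inversions n w" "f (i, j) = f (k, l)"
    then have "i < j" "k < l" "f (i, j) = f (k, l)"
      by (auto simp: inversions_def)
    then show "i = k \<and> j = l"
      unfolding f_def by (simp split: if_splits) (metis transpose_involutory less_asym)+
  qed
  have "f ` inversions n w \<subseteq> inversions n ?w - {(a, b)}"
  proof (rule image_subsetI)
    fix x assume "x \<in> inversions n w"
    then obtain i j where x: "x = (i, j)"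
      and r: "i \<in> {1..n}" "j \<in> {1..n}" "i < j" "w j < w i"
      by (auto simp: inversions_def)
    show "f x \<in> inversions n ?w - {(a, b)}"
    proof (cases "?t i < ?t j")
      case True
      then have "(?t i, ?t j) \<noteq> (a, b)"
        using r(3) ab(3) by (auto simp: transpose_def split: if_splits)
      then show ?thesis
        using True r t_range[of i] t_range[of j] by (simp add: x f_def inversions_def)
    next
      case False
      then have "?w j < ?w i \<and> (i, j) \<noteq> (a, b)"
        using r less ab by (auto simp: transpose_def split: if_splits)
      then show ?thesis
        using False r by (simp add: x f_def inversions_def)
    qed
  qed
  moreover have "(a, b) \<in> inversions n ?w"
    using ab less by (auto simp: inversions_def)
  ultimately have "f ` inversions n w \<subset> inversions n ?w"
    by blast
  then have "card (f ` inversions n w) < card (inversions n ?w)"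
    by (rule psubset_card_mono[OF finite_inversions])
  then show ?thesis
    unfolding len_def card_image[OF inj] .
qed

lemma bruhat_stepE:
  assumes "bruhat_step n v w"
  obtains a b where "1 \<le> a" "a < b" "v a < v b" "w = v \<circ> transpose a b"
proof -
  obtain a b where ab: "a \<in> {1..n}" "b \<in> {1..n}" "a < b" "w = v \<circ> transpose a b"
    using assms unfolding bruhat_step_def by (metis linorder_neqE_nat transpose_commute)
  have v: "inj v" and len: "len n v < len n w"
    using assms unfolding bruhat_step_def Sym_def by (auto intro: permutes_inj)
  \<comment> \<open>Otherwise the same transposition would lengthen \<open>w\<close> and lead back
    to \<open>v\<close>.\<close>
  have "\<not> v b < v a"
    using len_less_transpose[of a n b w] ab len by (auto simp: comp_assoc)
  moreover have "v a \<noteq> v b"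
    using v ab(3) by (auto dest: injD)
  ultimately show ?thesis
    using that ab by auto
qed

text \<open>If both swapped positions are at most \<open>p\<close>, the transposition carries one
  set into the other. If \<open>b > p\<close>, at most the position \<open>a\<close> changes, and
  its value rises. This is the easy direction of the rank criterion for the Bruhat order.\<close>

lemma bruhat_step_card_mono:
  assumes "bruhat_step n v w"
  shows "card {i \<in> {1..p}. q \<le> v i} \<le> card {i \<in> {1..p}. q \<le> w i}"
proof -
  obtain a b where ab: "1 \<le> a" "a < b" "v a < v b" "w = v \<circ> transpose a b"
    using assms by (rule bruhat_stepE)
  let ?t = "transpose a b"
  show ?thesis
  proof (cases "b \<le> p")
    case True
    then have "?t ` {i \<in> {1..p}. q \<le> v i} \<subseteq> {i \<in> {1..p}. q \<le> w i}"
      using ab by (auto simp: transpose_def)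
    moreover have "card (?t ` {i \<in> {1..p}. q \<le> v i}) = card {i \<in> {1..p}. q \<le> v i}"
      by (intro card_image inj_on_subset[OF inj_transpose]) auto
    ultimately show ?thesis
      using card_mono[of "{i \<in> {1..p}. q \<le> w i}" "?t ` {i \<in> {1..p}. q \<le> v i}"] by simp
  next
    case False
    then have "{i \<in> {1..p}. q \<le> v i} \<subseteq> {i \<in> {1..p}. q \<le> w i}"
      using ab by (auto simp: transpose_def)
    then show ?thesis
      by (intro card_mono) auto
  qed
qed

lemma bruhat_le_card_mono:
  assumes "bruhat_le n v w"
  shows "card {i \<in> {1..p}. q \<le> v i} \<le> card {i \<in> {1..p}. q \<le> w i}"
  using assms unfolding bruhat_le_def
proof (induction rule: rtranclp_induct)
  case (step y z)
  then show ?case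
    using bruhat_step_card_mono order_trans by blast
qed simp

section \<open>Rank counts of a class\<close>

text \<open>Among the positions up to \<open>a\<close> in \<open>E_pos\<close>, those with value
  below \<open>b\<close> are removed. The first number is \<open>a\<close> minus the right endpoints
  up to \<open>a\<close>, the second is \<open>b - 1\<close> minus the left endpoints below
  \<open>b\<close>; the surplus of left endpoints counts the arcs still open at \<open>t\<close>.
  The constant \<open>Suc a - b\<close> is 1 for even \<open>t\<close> and 0 for odd
  \<open>t\<close>.\<close>

lemma card_nc_class_eq_depth:
  assumes lam: "noncrossing_partition n lam" and w: "w \<in> nc_class n lam"
    and t: "0 < t" "t < 2 * n" and a: "a = t div 2" and b: "b = Suc t div 2"
  shows "card {i \<in> {1..a}. b \<le> w i} = Suc a - b + depth lam t"
proof -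
  have wn: "w permutes {1..n}" and val: "E_val n w = {1..n} - left_endpoints lam"
    and pos: "E_pos n w = {1..n} - right_endpoints lam"
    using w unfolding nc_class_def Sym_def by auto
  have card_Diff: "card (B - A) + card A = card B" if "A \<subseteq> B" "finite B" for A B :: "nat set"
    using that by (metis card_Diff_subset card_mono finite_subset le_add_diff_inverse2)
  have ab: "a \<le> b" "b \<le> Suc a" "1 \<le> b" "b \<le> n" "a \<le> n"
    using t a b by auto
  have iff: "i \<le> w i \<longleftrightarrow> i \<notin> right_endpoints lam" if "i \<in> {1..n}" for i
    using pos that unfolding E_pos_def by blast
  have fin: "finite lam"
    using lam by (rule finite_noncrossing_partition)
  have inj: "inj_on fst lam" "inj_on snd lam"
    using noncrossing_left_unique[OF lam] noncrossing_right_unique[OF lam]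
    by (auto intro!: inj_onI)
  let ?P = "{i \<in> {1..a}. i \<le> w i}" and ?H = "{i \<in> {1..a}. b \<le> w i}"
    and ?L = "{i \<in> {1..a}. i \<le> w i \<and> w i < b}"
  have "?P = ?H \<union> ?L" "?H \<inter> ?L = {}"
    using ab by auto
  then have P: "card ?P = card ?H + card ?L"
    by (simp add: card_Un_disjoint)
  have "?P = {1..a} - {j \<in> right_endpoints lam. j \<le> a}"
    using iff ab by auto
  moreover have "{j \<in> right_endpoints lam. j \<le> a} = snd ` {x \<in> lam. snd x \<le> a}"
    unfolding right_endpoints_def by auto
  moreover have "card (snd ` {x \<in> lam. snd x \<le> a}) = card {x \<in> lam. snd x \<le> a}"
    by (intro card_image inj_on_subset[OF inj(2)]) auto
  moreover have "snd ` {x \<in> lam. snd x \<le> a} \<subseteq> {1..a}"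
    using noncrossing_partitionD(1)[OF lam] by fastforce
  ultimately have P': "card ?P + card {x \<in> lam. snd x \<le> a} = a"
    using card_Diff[of "snd ` {x \<in> lam. snd x \<le> a}" "{1..a}"] by simp
  \<comment> \<open>A value \<open>w i < b\<close> with \<open>i \<le> w i\<close> comes from a
    position \<open>i < b\<close>, hence \<open>i \<le> a\<close>, so the bound on positions
    excludes none of these values.\<close>
  have "w ` ?L = {1..<b} - {i \<in> left_endpoints lam. i < b}"
  proof -
    have "w ` ?L = {y \<in> E_val n w. y < b}"
    proof
      show "w ` ?L \<subseteq> {y \<in> E_val n w. y < b}"
        using ab unfolding E_val_def by auto
      show "{y \<in> E_val n w. y < b} \<subseteq> w ` ?L"
      proof
        fix y assume "y \<in> {y \<in> E_val n w. y < b}"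
        then obtain i where i: "y = w i" "i \<in> {1..n}" "i \<le> w i" "w i < b"
          unfolding E_val_def by blast
        then have "i \<in> ?L"
          using ab by simp
        then show "y \<in> w ` ?L"
          using i(1) by blast
      qed
    qed
    then show ?thesis
      unfolding val using ab by auto
  qed
  moreover have "{i \<in> left_endpoints lam. i < b} = fst ` {x \<in> lam. fst x < b}"
    unfolding left_endpoints_def by auto
  moreover have "card (fst ` {x \<in> lam. fst x < b}) = card {x \<in> lam. fst x < b}"
    by (intro card_image inj_on_subset[OF inj(1)]) auto
  moreover have "fst ` {x \<in> lam. fst x < b} \<subseteq> {1..<b}"
    using noncrossing_partitionD(1)[OF lam] by fastforce
  moreover have "card (w ` ?L) = card ?L"
    by (intro card_image inj_on_subset[OF permutes_inj[OF wn]]) auto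
  ultimately have L: "card ?L + card {x \<in> lam. fst x < b} = b - 1"
    using card_Diff[of "fst ` {x \<in> lam. fst x < b}" "{1..<b}"] by simp
  let ?D = "{(i, j) \<in> lam. 2 * i < t \<and> t < 2 * j}"
  \<comment> \<open>With these roundings \<open>2 * i < t\<close> means \<open>i < b\<close>, and
    \<open>t < 2 * j\<close> means \<open>a < j\<close>.\<close>
  have "{x \<in> lam. fst x < b} = {x \<in> lam. snd x \<le> a} \<union> ?D"
    using noncrossing_partitionD(1)[OF lam] a b by fastforce
  moreover have "{x \<in> lam. snd x \<le> a} \<inter> ?D = {}"
    using a by auto
  moreover have "finite ?D"
    using fin by (rule finite_subset[rotated]) auto
  ultimately have "card {x \<in> lam. fst x < b} = card {x \<in> lam. snd x \<le> a} + depth lam t"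
    using fin unfolding depth_def by (simp add: card_Un_disjoint)
  then show ?thesis
    using P P' L ab by linarith
qed

lemma nc_le_if_bruhat_le:
  assumes lam: "noncrossing_partition n lam" and mu: "noncrossing_partition n mu"
    and v: "v \<in> nc_class n lam" and w: "w \<in> nc_class n mu" and le: "bruhat_le n v w"
  shows "nc_le n lam mu"
proof (rule nc_le_if_depth_le[OF lam mu])
  fix t
  show "depth lam t \<le> depth mu t"
  proof (cases "0 < t \<and> t < 2 * n")
    case True
    then show ?thesis
      using card_nc_class_eq_depth[OF lam v, of t] card_nc_class_eq_depth[OF mu w, of t]
        bruhat_le_card_mono[OF le, of "t div 2" "Suc t div 2"] by simp
  next
    case False
    then show ?thesis
      using depth_eq_0[OF lam, of t] by (cases "t = 0") (auto simp: depth_def)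
  qed
qed

section \<open>Noncrossing permutations\<close>

text \<open>The relation holds for exactly one permutation, the one whose cycles are the blocks of
  \<open>lam\<close>: the least element of a block is mapped to the greatest one, and any other element to its
  predecessor in the block.\<close>

definition block_perm :: "nat \<Rightarrow> (nat \<times> nat) set \<Rightarrow> (nat \<Rightarrow> nat) \<Rightarrow> bool" where
  "block_perm n lam w \<longleftrightarrow> w \<in> Sym n \<and> (\<forall>(i, j) \<in> lam. w j = i) \<and>
     (\<forall>x \<in> {1..n} - right_endpoints lam. (x, w x) \<in> lam\<^sup>*)"

lemma rtrancl_arcs_le:
  assumes "noncrossing_partition n lam" "(x, y) \<in> lam\<^sup>*"
  shows "x \<le> y"
  using assms(2)
proof (induction rule: rtrancl_induct)
  case (step y z)
  then show ?case
    using noncrossing_partitionD(1)[OF assms(1), of y z] by simp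
qed simp

text \<open>Right endpoints are sent strictly down to their left endpoints, and all other elements
  weakly up along a chain of arcs. The values at the latter are therefore the complement of the left
  endpoints.\<close>

lemma block_perm_in_nc_class:
  assumes lam: "noncrossing_partition n lam" and w: "block_perm n lam w"
  shows "w \<in> nc_class n lam"
proof -
  have wn: "w permutes {1..n}"
    and arc: "\<And>i j. (i, j) \<in> lam \<Longrightarrow> w j = i"
    and chain: "\<And>x. x \<in> {1..n} - right_endpoints lam \<Longrightarrow> (x, w x) \<in> lam\<^sup>*"
    using w unfolding block_perm_def Sym_def by auto
  have "w x < x" if "x \<in> right_endpoints lam" for x
    using that arc noncrossing_partitionD(1)[OF lam] unfolding right_endpoints_def by force
  moreover have "x \<le> w x" if "x \<in> {1..n} - right_endpoints lam" for x
    using rtrancl_arcs_le[OF lam chain[OF that]] .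
  ultimately have pos: "E_pos n w = {1..n} - right_endpoints lam"
    unfolding E_pos_def by (auto simp: not_le[symmetric])
  have "E_val n w = w ` E_pos n w"
    unfolding E_val_def E_pos_def by auto
  also have "\<dots> = w ` {1..n} - w ` right_endpoints lam"
    unfolding pos using permutes_inj[OF wn] by (simp add: image_set_diff)
  also have "w ` {1..n} = {1..n}"
    using wn by (rule permutes_image)
  also have "w ` right_endpoints lam = left_endpoints lam"
    using arc unfolding right_endpoints_def left_endpoints_def by (force simp: image_image)
  finally show ?thesis
    using pos wn unfolding nc_class_def Sym_def by auto
qed

lemma block_perm_bruhat_step:
  assumes w: "block_perm n lam w" and ab: "a \<in> {1..n}" "b \<in> {1..n}" "a < b" "w a < w b"
  shows "w \<circ> transpose a b \<in> Sym n" "bruhat_step n w (w \<circ> transpose a b)"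
proof -
  have "w permutes {1..n}"
    using w unfolding block_perm_def Sym_def by auto
  then show *: "w \<circ> transpose a b \<in> Sym n"
    unfolding Sym_def using ab by (auto intro!: permutes_compose permutes_swap_id)
  show "bruhat_step n w (w \<circ> transpose a b)"
    unfolding bruhat_step_def
  proof (intro conjI bexI)
    show "len n w < len n (w \<circ> transpose a b)"
      using ab by (rule len_less_transpose)
  qed (use * w ab in \<open>auto simp: block_perm_def\<close>)
qed

text \<open>The new arc joins the block with greatest element \<open>i\<close> to the block with
  least element \<open>Suc i\<close>. Swapping the images of the two least elements merges the
  cycles, and it is length-increasing since \<open>i\<close> is below the greatest element of the
  second block.\<close>

lemma block_perm_add_arc:
  assumes mu: "noncrossing_partition n mu" and arc: "(i, Suc i) \<in> mu"
    and lam: "lam = mu - {(i, Suc i)}" and w: "block_perm n lam w"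
  shows "\<exists>w'. block_perm n mu w' \<and> bruhat_step n w w'"
proof -
  have wn: "w permutes {1..n}"
    and warc: "\<And>i j. (i, j) \<in> lam \<Longrightarrow> w j = i"
    and chain: "\<And>x. x \<in> {1..n} - right_endpoints lam \<Longrightarrow> (x, w x) \<in> lam\<^sup>*"
    using w unfolding block_perm_def Sym_def by auto
  have nc_lam: "noncrossing_partition n lam"
    using mu unfolding lam noncrossing_partition_def by blast
  have i: "1 \<le> i" "Suc i \<le> n"
    using noncrossing_partitionD(1)[OF mu arc] by auto
  have nl: "i \<notin> left_endpoints lam"
    using noncrossing_left_unique[OF mu arc] unfolding lam left_endpoints_def by auto
  have nr: "Suc i \<notin> right_endpoints lam"
    using noncrossing_right_unique[OF mu arc] unfolding lam right_endpoints_def by auto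
  \<comment> \<open>The preimage of \<open>i\<close> turns out to be the least element of the block
    of \<open>i\<close>.\<close>
  obtain m where m: "m \<in> {1..n}" "w m = i"
    using permutes_image[OF wn] i by (metis atLeastAtMost_iff imageE Suc_leD)
  have mr: "m \<notin> right_endpoints lam"
    using nl m(2) warc unfolding left_endpoints_def right_endpoints_def by force
  have mi: "(m, i) \<in> lam\<^sup>*"
    using chain[of m] m mr by auto
  have iw: "(Suc i, w (Suc i)) \<in> lam\<^sup>*"
    using chain[of "Suc i"] i nr by auto
  have le: "m \<le> i" "Suc i \<le> w (Suc i)"
    using rtrancl_arcs_le[OF nc_lam] mi iw by auto
  let ?w = "w \<circ> transpose m (Suc i)"
  have step: "?w \<in> Sym n" "bruhat_step n w ?w"
    using block_perm_bruhat_step[OF w, of m "Suc i"] m i le by auto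
  have mono: "(x, y) \<in> lam\<^sup>* \<Longrightarrow> (x, y) \<in> mu\<^sup>*" for x y
    using rtrancl_mono[of lam mu] unfolding lam by auto
  have "?w q = p" if "(p, q) \<in> mu" for p q
  proof (cases "(p, q) = (i, Suc i)")
    case False
    then have "(p, q) \<in> lam"
      using that lam by auto
    moreover from this have "q \<noteq> m" "q \<noteq> Suc i"
      using mr nr unfolding right_endpoints_def by force+
    ultimately show ?thesis
      using warc by simp
  qed (use m in auto)
  moreover have "(x, ?w x) \<in> mu\<^sup>*" if x: "x \<in> {1..n} - right_endpoints mu" for x
  proof (cases "x = m")
    case True
    then show ?thesis
      using rtrancl_trans[OF rtrancl_into_rtrancl[OF mono[OF mi] arc] mono[OF iw]] by simp
  next
    case False
    moreover have "x \<noteq> Suc i" "x \<notin> right_endpoints lam"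
      using x arc unfolding lam right_endpoints_def by force+
    ultimately show ?thesis
      using mono[OF chain[of x]] x by simp
  qed
  ultimately have "block_perm n mu ?w"
    using step(1) unfolding block_perm_def by auto
  then show ?thesis
    using step(2) by blast
qed

text \<open>Passing from \<open>lam\<close> to \<open>mu\<close> takes \<open>j\<close> out of its
  block. The images \<open>i\<close> of \<open>j\<close> and \<open>j\<close> of \<open>k\<close>
  are swapped, so \<open>j\<close> becomes a fixed point and \<open>k\<close> goes to
  \<open>i\<close>; the length increases since \<open>i < j\<close>.\<close>

lemma block_perm_merge_arcs:
  assumes mu: "noncrossing_partition n mu" and arc: "(i, k) \<in> mu" and ijk: "i < j" "j < k"
    and nl: "j \<notin> left_endpoints mu" and nr: "j \<notin> right_endpoints mu"
    and lam: "lam = (mu - {(i, k)}) \<union> {(i, j), (j, k)}" and w: "block_perm n lam w"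
  shows "\<exists>w'. block_perm n mu w' \<and> bruhat_step n w w'"
proof -
  have wn: "w permutes {1..n}"
    and warc: "\<And>i j. (i, j) \<in> lam \<Longrightarrow> w j = i"
    and chain: "\<And>x. x \<in> {1..n} - right_endpoints lam \<Longrightarrow> (x, w x) \<in> lam\<^sup>*"
    using w unfolding block_perm_def Sym_def by auto
  have ik: "1 \<le> i" "k \<le> n"
    using noncrossing_partitionD(1)[OF mu arc] by auto
  have wj: "w j = i" "w k = j"
    using warc lam by auto
  let ?w = "w \<circ> transpose j k"
  have step: "?w \<in> Sym n" "bruhat_step n w ?w"
    using block_perm_bruhat_step[OF w, of j k] wj ijk ik by auto
  \<comment> \<open>A path of \<open>lam\<close> is rerouted in \<open>mu\<close> around
    \<open>j\<close>: it waits at \<open>i\<close> while the original is at \<open>j\<close>, and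
    then uses the arc \<open>(i, k)\<close>.\<close>
  have shortcut: "if y = j then (x, i) \<in> mu\<^sup>* else (x, y) \<in> mu\<^sup>*"
    if "(x, y) \<in> lam\<^sup>*" "x \<noteq> j" for x y
    using that(1)
  proof (induction rule: rtrancl_induct)
    case base
    then show ?case
      using that(2) by simp
  next
    case (step y z)
    consider "(y, z) \<in> mu" | "(y, z) = (i, j)" | "(y, z) = (j, k)"
      using step.hyps(2) lam by auto
    then show ?case
    proof cases
      case 1
      then have "y \<noteq> j" "z \<noteq> j"
        using nl nr unfolding left_endpoints_def right_endpoints_def by force+
      then show ?thesis
        using 1 step.IH by auto
    next
      case 2
      then show ?thesis
        using step.IH ijk by auto
    next
      case 3
      then show ?thesis
        using step.IH ijk arc by auto
    qed
  qed
  have "?w q = p" if "(p, q) \<in> mu" for p q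
  proof (cases "(p, q) = (i, k)")
    case False
    then have "(p, q) \<in> lam"
      using that lam by auto
    moreover have "q \<noteq> k"
      using noncrossing_right_unique[OF mu arc, of p] that False by auto
    moreover have "q \<noteq> j"
      using that nr unfolding right_endpoints_def by force
    ultimately show ?thesis
      using warc by simp
  qed (use wj in auto)
  moreover have "(x, ?w x) \<in> mu\<^sup>*" if x: "x \<in> {1..n} - right_endpoints mu" for x
  proof (cases "x = j")
    case True
    then show ?thesis
      using wj by simp
  next
    case False
    moreover have xk: "x \<noteq> k"
      using x arc unfolding right_endpoints_def by force
    moreover have "x \<notin> right_endpoints lam"
      using x False xk unfolding lam right_endpoints_def by auto
    \<comment> \<open>This selects the case of \<open>shortcut\<close> in which the rerouted path
      reaches \<open>w x\<close> itself.\<close>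
    moreover have "w x \<noteq> j"
      using wj(2) xk permutes_inj[OF wn] by (metis injD)
    ultimately show ?thesis
      using shortcut[OF chain[of x]] x by simp
  qed
  ultimately have "block_perm n mu ?w"
    using step(1) unfolding block_perm_def by auto
  then show ?thesis
    using step(2) by blast
qed

lemma block_perm_cover:
  assumes "nc_cover n lam mu" "block_perm n lam w"
  shows "\<exists>w'. block_perm n mu w' \<and> bruhat_step n w w'"
proof -
  have mu: "noncrossing_partition n mu"
    using assms(1) unfolding nc_cover_def by blast
  from assms(1) consider
      i where "(i, Suc i) \<in> mu" "lam = mu - {(i, Suc i)}"
    | i j k where "i < j" "j < k" "(i, k) \<in> mu" "lam = (mu - {(i, k)}) \<union> {(i, j), (j, k)}"
        "\<forall>a \<in> {(i, j), (j, k)}. \<forall>b \<in> mu - {(i, k)}. fst a \<noteq> fst b \<and> snd a \<noteq> snd b"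
    unfolding nc_cover_def by (metis Suc_eq_plus1)
  then show ?thesis
  proof cases
    case 1
    then show ?thesis
      using block_perm_add_arc[OF mu _ _ assms(2)] by blast
  next
    case 2
    have "fst b \<noteq> j \<and> snd b \<noteq> j" if "b \<in> mu" for b
      using that 2 by (cases "b = (i, k)") auto
    then have "j \<notin> left_endpoints mu" "j \<notin> right_endpoints mu"
      unfolding left_endpoints_def right_endpoints_def by auto
    then show ?thesis
      using block_perm_merge_arcs[OF mu 2(3,1,2) _ _ 2(4) assms(2)] by blast
  qed
qed

lemma block_perm_nc_le:
  assumes "nc_le n lam mu" "block_perm n lam v"
  shows "\<exists>w. block_perm n mu w \<and> bruhat_le n v w"
  using assms(1) unfolding nc_le_def bruhat_le_def
proof (induction rule: rtranclp_induct)
  case base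
  then show ?case
    using assms(2) by blast
next
  case (step mu nu)
  then show ?case
    using block_perm_cover by (meson rtranclp.rtrancl_into_rtrancl)
qed

text \<open>The empty partition lies below all others, since its depths vanish, and it is
  represented by the identity; representatives are then carried upwards along covering
  relations.\<close>

lemma ex_block_perm:
  assumes "noncrossing_partition n lam"
  shows "\<exists>w. block_perm n lam w"
proof -
  have "block_perm n {} id"
    unfolding block_perm_def Sym_def by (simp add: permutes_id)
  moreover have "nc_le n {} lam"
    using assms by (intro nc_le_if_depth_le) (auto simp: noncrossing_partition_def)
  ultimately show ?thesis
    using block_perm_nc_le by blast
qed

section \<open>Comparison of the two orders\<close>

text \<open>The point is that the class is inhabited: a permutation with the prescribed
  \<open>E_pos\<close> and \<open>E_val\<close> exists, and the set is its equivalence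
  class.\<close>

lemma nc_class_in_excedance_classes:
  assumes "noncrossing_partition n lam"
  shows "nc_class n lam \<in> excedance_classes n"
proof -
  obtain w where w: "w \<in> nc_class n lam"
    using ex_block_perm[OF assms] block_perm_in_nc_class[OF assms] by blast
  then have "nc_class n lam = excedance_rel n `` {w}"
    unfolding nc_class_def excedance_rel_def by auto
  moreover have "w \<in> Sym n"
    using w unfolding nc_class_def by simp
  ultimately show ?thesis
    unfolding excedance_classes_def by (auto intro: quotientI)
qed

theorem theorem4p2:
  fixes n :: nat and lam mu :: "(nat \<times> nat) set"
  assumes "noncrossing_partition n lam" and "noncrossing_partition n mu"
  shows "class_le n (nc_class n lam) (nc_class n mu) \<longleftrightarrow> nc_le n lam mu"
proof
  assume "class_le n (nc_class n lam) (nc_class n mu)"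
  then show "nc_le n lam mu"
    using nc_le_if_bruhat_le[OF assms] unfolding class_le_def by blast
next
  assume le: "nc_le n lam mu"
  obtain v where v: "block_perm n lam v"
    using ex_block_perm[OF assms(1)] ..
  then obtain w where "block_perm n mu w" "bruhat_le n v w"
    using block_perm_nc_le[OF le] by blast
  then show "class_le n (nc_class n lam) (nc_class n mu)"
    using v assms block_perm_in_nc_class nc_class_in_excedance_classes
    unfolding class_le_def by blast
qed

end
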